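(* Let $P$ be a triangle in the Euclidean plane with side lengths $a\geq b\geq c$ and with angles $\alpha\geq\beta\geq\gamma$, where $\alpha,\beta,\gamma$ are the angles opposite to the sides of length $a,b,c$ respectively. Then $$ \delta(P)= \begin{cases} \dfrac{a}{2} & \text{for } \alpha\geq \pi/2,\\[2mm] b\sin(\gamma) & \text{for } \gamma\geq \pi/4,\\[2mm] \dfrac{b}{2\cos(\gamma)} & \text{for } \gamma\leq \pi/4 \text{ and } \alpha\leq \pi/2. \end{cases} $$
   Context: The plane $\mathbb{R}^2$ carries the standard Euclidean metric $d$. A triangle $P$ is understood as a closed polygonal curve (the union of its three sides, without the interior), and it is nondegenerate. For a compact set $\Gamma\subset\mathbb{R}^2$, the relative Chebyshev radius of $\Gamma$ (with respect to itself) is $$\delta(\Gamma)=\min_{p\in\Gamma}\max_{q\in\Gamma} d(p,q),$$ i.e. the smallest radius of a disk with center in $\Gamma$ covering $\Gamma$. *)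

theory Defs
  imports "HOL-Analysis.Analysis"
begin

text \<open>
  The infimum and the supremum are totalised versions of the minimum and the maximum; for a
  nonempty compact set both are attained, as the two lemmas below show.
\<close>

definition rel_chebyshev_radius :: "'a::metric_space set \<Rightarrow> real" where
  "rel_chebyshev_radius \<Gamma> = (INF p\<in>\<Gamma>. SUP q\<in>\<Gamma>. dist p q)"

lemma farthest_dist_attained:
  fixes \<Gamma> :: "'a::metric_space set"
  assumes "compact \<Gamma>" "\<Gamma> \<noteq> {}"
  shows "\<exists>q\<in>\<Gamma>. (SUP q\<in>\<Gamma>. dist p q) = dist p q \<and> (\<forall>q'\<in>\<Gamma>. dist p q' \<le> dist p q)"
proof -
  have "continuous_on \<Gamma> (\<lambda>q. dist p q)"
    by (intro continuous_intros)
  then obtain q where q: "q \<in> \<Gamma>" "\<forall>q'\<in>\<Gamma>. dist p q' \<le> dist p q"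
    using continuous_attains_sup[OF assms] by blast
  then have "(SUP q\<in>\<Gamma>. dist p q) = dist p q"
    by (intro cSup_eq_maximum) auto
  with q show ?thesis by blast
qed

lemma rel_chebyshev_radius_attained:
  fixes \<Gamma> :: "'a::metric_space set"
  assumes "compact \<Gamma>" "\<Gamma> \<noteq> {}"
  shows "\<exists>p\<in>\<Gamma>. rel_chebyshev_radius \<Gamma> = (SUP q\<in>\<Gamma>. dist p q) \<and>
           (\<forall>p'\<in>\<Gamma>. (SUP q\<in>\<Gamma>. dist p q) \<le> (SUP q\<in>\<Gamma>. dist p' q))"
proof -
  define f where "f = (\<lambda>p. SUP q\<in>\<Gamma>. dist p q)"
  have le: "f x \<le> f y + dist x y" for x y
  proof -
    obtain q where q: "q \<in> \<Gamma>" "f x = dist x q"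
      using farthest_dist_attained[OF assms] unfolding f_def by blast
    obtain q' where q': "f y = dist y q'" "\<forall>z\<in>\<Gamma>. dist y z \<le> dist y q'"
      using farthest_dist_attained[OF assms] unfolding f_def by blast
    have "dist x q \<le> dist x y + dist y q"
      by (rule dist_triangle)
    with q q' show ?thesis by fastforce
  qed
  have "dist (f x) (f y) \<le> dist x y" for x y
    using le[of x y] le[of y x] by (simp add: dist_real_def dist_commute abs_le_iff)
  then have "continuous_on \<Gamma> f"
    unfolding continuous_on_iff by (meson le_less_trans)
  then obtain p where p: "p \<in> \<Gamma>" "\<forall>p'\<in>\<Gamma>. f p \<le> f p'"
    using continuous_attains_inf[OF assms] by blast
  then have "(INF p\<in>\<Gamma>. f p) = f p"
    by (intro cInf_eq_minimum) auto
  with p show ?thesis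
    unfolding rel_chebyshev_radius_def f_def by blast
qed

definition triangle_curve :: "'a::euclidean_space \<Rightarrow> 'a \<Rightarrow> 'a \<Rightarrow> 'a set" where
  "triangle_curve A B C = closed_segment A B \<union> closed_segment B C \<union> closed_segment C A"

text \<open>The middle argument is the vertex; the value is meaningful when it differs from the other two points.\<close>

definition angle_at :: "'a::euclidean_space \<Rightarrow> 'a \<Rightarrow> 'a \<Rightarrow> real" where
  "angle_at X V Y = arccos (((X - V) \<bullet> (Y - V)) / (norm (X - V) * norm (Y - V)))"

end

theory Submission
  imports Defs
begin

text \<open>
  Balls are convex, so a disk covers a triangle as soon as it covers the three vertices. Hence the
  claimed value \<open>r\<close> is the relative Chebyshev radius once some point of the triangle has distance
  at most \<open>r\<close> from every vertex, and every point of the triangle has distance at least \<open>r\<close> from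
  some vertex (\<open>rel_chebyshev_radius_triangle_eqI\<close>).

  An optimal centre always lies on the longest side \<open>BC\<close>. If \<open>\<alpha> \<ge> \<pi>/2\<close>, it is the midpoint
  of \<open>BC\<close>: the disk with diameter \<open>BC\<close> contains \<open>A\<close>, and no smaller disk contains \<open>B\<close> and \<open>C\<close>.
  If \<open>\<gamma> \<ge> \<pi>/4\<close>, it is the foot of the altitude from \<open>A\<close>: the two base angles are at least
  \<open>\<pi>/4\<close>, so this altitude, of length \<open>b sin \<gamma>\<close>, is at least as long as both pieces into which its
  foot cuts \<open>BC\<close>, and it is the shortest altitude, so that each point of the triangle is at least
  that far from the vertex opposite to its side. In the remaining case, it is the point where the
  perpendicular bisector of \<open>CA\<close> meets \<open>BC\<close>; it has distance \<open>b / (2 cos \<gamma>)\<close> from \<open>C\<close> and \<open>A\<close>,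
  and \<open>B\<close> is no farther because \<open>\<alpha> \<le> \<pi>/2\<close> forces \<open>a cos \<gamma> \<le> b\<close>. The lower bound comes from
  comparing the distance to \<open>C\<close> with the distance to \<open>A\<close> for points of \<open>BC\<close>, and with the
  distance to \<open>B\<close> for points of \<open>CA\<close>, while the points of \<open>AB\<close> are far from \<open>C\<close>.

  All distances are computed with the law of cosines for a point moving along a side
  (\<open>law_of_cosines_on_side\<close>).
\<close>

section \<open>Disks covering a triangle\<close>

lemma vertices_in_triangle_curve:
  "A \<in> triangle_curve A B C" "B \<in> triangle_curve A B C" "C \<in> triangle_curve A B C"
  by (auto simp: triangle_curve_def)

lemma compact_triangle_curve: "compact (triangle_curve A B C)"
  unfolding triangle_curve_def by (intro compact_Un compact_segment)

lemma triangle_curve_subset_convex: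
  assumes "convex S" "A \<in> S" "B \<in> S" "C \<in> S"
  shows "triangle_curve A B C \<subseteq> S"
  using assms unfolding triangle_curve_def by (simp add: closed_segment_subset)

text \<open>
  The inner supremum is attained at a vertex, because a ball around \<open>p\<close> that contains the vertices
  contains their whole triangle.
\<close>

lemma rel_chebyshev_radius_triangle_eqI:
  fixes A B C :: "'a::euclidean_space"
  assumes p: "p \<in> triangle_curve A B C"
    and upper: "dist p A \<le> r" "dist p B \<le> r" "dist p C \<le> r"
    and lower: "\<And>x. x \<in> triangle_curve A B C \<Longrightarrow> r \<le> dist x A \<or> r \<le> dist x B \<or> r \<le> dist x C"
  shows "rel_chebyshev_radius (triangle_curve A B C) = r"
proof -
  let ?P = "triangle_curve A B C"
  define f where "f = (\<lambda>x. SUP q\<in>?P. dist x q)"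
  have f_ge: "r \<le> f x" if x: "x \<in> ?P" for x
  proof -
    obtain q where "f x = dist x q" "\<forall>q'\<in>?P. dist x q' \<le> dist x q"
      using farthest_dist_attained[OF compact_triangle_curve[of A B C]] p
      unfolding f_def by blast
    with lower[OF x] vertices_in_triangle_curve[where A = A and B = B and C = C] show ?thesis
      by (metis order_trans)
  qed
  have "?P \<subseteq> cball p r"
    using upper by (intro triangle_curve_subset_convex) auto
  then have "f p \<le> r"
    using p unfolding f_def by (intro cSUP_least) auto
  with f_ge[OF p] have "f p = r"
    by simp
  then have "(INF x\<in>?P. f x) = r"
    using p f_ge by (intro cInf_eq_minimum) auto
  then show ?thesis
    by (simp add: rel_chebyshev_radius_def f_def)
qed

section \<open>Distances from a vertex to the points of a side\<close>

lemma angle_at_commute: "angle_at X V Y = angle_at Y V X"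
  by (simp add: angle_at_def inner_commute mult.commute)

text \<open>The Cauchy-Schwarz inequality says that the argument of the arc cosine is legitimate.\<close>

lemma angle_at_quotient_bounds:
  fixes X V Y :: "'a::euclidean_space"
  shows "\<bar>((X - V) \<bullet> (Y - V)) / (norm (X - V) * norm (Y - V))\<bar> \<le> 1"
  using Cauchy_Schwarz_ineq2[of "X - V" "Y - V"]
  by (cases "X = V \<or> Y = V") (auto simp: divide_le_eq_1 abs_mult zero_less_mult_iff)

lemma angle_at_bounds: "0 \<le> angle_at X V Y" "angle_at X V Y \<le> pi"
  unfolding angle_at_def
  by (rule arccos_lbound arccos_ubound; use angle_at_quotient_bounds[of X V Y] in linarith)+

lemma inner_eq_cos_angle_at:
  fixes X V Y :: "'a::euclidean_space"
  assumes "X \<noteq> V" "Y \<noteq> V"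
  shows "(X - V) \<bullet> (Y - V) = dist V X * dist V Y * cos (angle_at X V Y)"
  using angle_at_quotient_bounds[of X V Y] assms
  by (simp add: angle_at_def cos_arccos_abs dist_norm norm_minus_commute)

text \<open>
  As \<open>p\<close> lies on the side \<open>VX\<close>, the triangles \<open>V\<close>, \<open>p\<close>, \<open>Y\<close> and \<open>V\<close>, \<open>X\<close>, \<open>Y\<close> have the same angle
  at \<open>V\<close>. Writing the angle with \<open>X\<close> covers \<open>p = V\<close> as well, where the former triangle has no angle.
  The usual law of cosines is the case \<open>p = X\<close>.
\<close>

lemma law_of_cosines_on_side:
  fixes X V Y :: "'a::euclidean_space"
  assumes neq: "X \<noteq> V" "Y \<noteq> V" and p: "p \<in> closed_segment V X"
  shows "(dist p Y)\<^sup>2 =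
    (dist V p)\<^sup>2 + (dist V Y)\<^sup>2 - 2 * dist V p * dist V Y * cos (angle_at X V Y)"
proof -
  obtain u where u: "0 \<le> u" "p - V = u *\<^sub>R (X - V)"
    using p by (auto simp: in_segment algebra_simps)
  have Vp: "dist V p = u * dist V X"
    using u by (metis abs_of_nonneg dist_commute dist_norm norm_scaleR)
  have "(dist p Y)\<^sup>2 = (norm ((p - V) - (Y - V)))\<^sup>2"
    by (simp add: dist_norm)
  also have "\<dots> = (dist V p)\<^sup>2 + (dist V Y)\<^sup>2 - 2 * ((p - V) \<bullet> (Y - V))"
    by (simp add: dot_norm_neg dist_norm norm_minus_commute field_simps)
  also have "(p - V) \<bullet> (Y - V) = dist V p * dist V Y * cos (angle_at X V Y)"
    using inner_eq_cos_angle_at[OF neq] by (simp add: u Vp)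
  finally show ?thesis
    by simp
qed

lemma law_of_cosines:
  fixes X V Y :: "'a::euclidean_space"
  assumes "X \<noteq> V" "Y \<noteq> V"
  shows "(dist X Y)\<^sup>2 =
    (dist V X)\<^sup>2 + (dist V Y)\<^sup>2 - 2 * dist V X * dist V Y * cos (angle_at X V Y)"
  by (rule law_of_cosines_on_side[OF assms ends_in_segment(2)])

text \<open>The distance from \<open>Y\<close> to the line \<open>VX\<close> is the altitude, and \<open>p\<close> lies on that line.\<close>

lemma altitude_le_dist:
  fixes X V Y :: "'a::euclidean_space"
  assumes neq: "X \<noteq> V" "Y \<noteq> V" and p: "p \<in> closed_segment V X"
  shows "dist V Y * sin (angle_at X V Y) \<le> dist p Y"
proof (rule power2_le_imp_le)
  let ?s = "sin (angle_at X V Y)" and ?c = "cos (angle_at X V Y)"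
  have "(dist p Y)\<^sup>2 = (dist V p - dist V Y * ?c)\<^sup>2 + (dist V Y)\<^sup>2 * (1 - ?c\<^sup>2)"
    by (simp add: law_of_cosines_on_side[OF neq p]) algebra
  then show "(dist V Y * ?s)\<^sup>2 \<le> (dist p Y)\<^sup>2"
    by (simp add: power_mult_distrib sin_squared_eq)
qed simp

lemma point_on_segment_at_distance:
  fixes V X :: "'a::euclidean_space"
  assumes "0 \<le> t" "t \<le> dist V X"
  obtains p where "p \<in> closed_segment V X" "dist V p = t" "dist p X = dist V X - t"
proof (cases "V = X")
  case True
  with assms that[of V] show ?thesis by simp
next
  case False
  define p where "p = (1 - t / dist V X) *\<^sub>R V + (t / dist V X) *\<^sub>R X"
  have p: "p \<in> closed_segment V X"
    using assms False unfolding p_def in_segment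
    by (intro exI[of _ "t / dist V X"]) (simp add: divide_le_eq_1)
  have "V - p = (t / dist V X) *\<^sub>R (V - X)"
    by (simp add: p_def algebra_simps)
  then have "dist V p = t"
    using assms False by (simp add: dist_norm)
  moreover have "dist V X = dist V p + dist p X"
    using p by (simp add: between flip: between_mem_segment)
  ultimately show ?thesis
    using p that by simp
qed

section \<open>The relative Chebyshev radius of a triangle\<close>

theorem theorem2:
  fixes A B C :: "real ^ 2" and P :: "(real ^ 2) set"
    and a b c \<alpha> \<beta> \<gamma> :: real
  assumes nondegenerate: "\<not> collinear {A, B, C}"
    and P: "P = triangle_curve A B C"
    and sides: "a = dist B C" "b = dist C A" "c = dist A B"
    and angles: "\<alpha> = angle_at B A C" "\<beta> = angle_at C B A" "\<gamma> = angle_at A C B"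
    and side_order: "a \<ge> b" "b \<ge> c"
    and angle_order: "\<alpha> \<ge> \<beta>" "\<beta> \<ge> \<gamma>"
  shows "(\<alpha> \<ge> pi / 2 \<longrightarrow> rel_chebyshev_radius P = a / 2) \<and>
         (\<gamma> \<ge> pi / 4 \<longrightarrow> rel_chebyshev_radius P = b * sin \<gamma>) \<and>
         (\<gamma> \<le> pi / 4 \<and> \<alpha> \<le> pi / 2 \<longrightarrow> rel_chebyshev_radius P = b / (2 * cos \<gamma>))"
proof -
  have neq: "A \<noteq> B" "B \<noteq> C" "A \<noteq> C"
    using nondegenerate by (auto simp: insert_commute)
  then have pos: "a > 0" "b > 0" "c > 0"
    by (auto simp: sides)
  note dists = sides[symmetric] sides[unfolded dist_commute[of B C] dist_commute[of C A]
    dist_commute[of A B], symmetric]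
  have angles': "angle_at C A B = \<alpha>" "angle_at A B C = \<beta>" "angle_at B C A = \<gamma>"
    by (simp_all add: angles angle_at_commute)
  have range: "0 \<le> \<alpha>" "\<alpha> \<le> pi" "0 \<le> \<beta>" "\<beta> \<le> pi" "0 \<le> \<gamma>" "\<gamma> \<le> pi"
    by (auto simp: angles angle_at_bounds)
  have cos_\<alpha>: "a\<^sup>2 = b\<^sup>2 + c\<^sup>2 - 2 * b * c * cos \<alpha>"
    using law_of_cosines[of C A B] neq by (simp add: dists angles')
  have cos_\<beta>: "b\<^sup>2 = c\<^sup>2 + a\<^sup>2 - 2 * c * a * cos \<beta>"
    using law_of_cosines[of A B C] neq by (simp add: dists angles' dist_commute[of A C])
  have cos_\<gamma>: "c\<^sup>2 = a\<^sup>2 + b\<^sup>2 - 2 * a * b * cos \<gamma>"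
    using law_of_cosines[of B C A] neq by (simp add: dists angles' dist_commute[of B A])

  have on_BC: "(dist x A)\<^sup>2 = (dist C x)\<^sup>2 + b\<^sup>2 - 2 * dist C x * (b * cos \<gamma>)"
    if "x \<in> closed_segment B C" for x
    using law_of_cosines_on_side[of B C A x] neq that
    by (simp add: dists angles' closed_segment_commute mult.assoc)
  have on_CA: "(dist x B)\<^sup>2 = (dist C x)\<^sup>2 + a\<^sup>2 - 2 * dist C x * (a * cos \<gamma>)"
    if "x \<in> closed_segment C A" for x
    using law_of_cosines_on_side[of A C B x] neq that
    by (simp add: dists angles closed_segment_commute mult.assoc)

  have obtuse: "rel_chebyshev_radius P = a / 2" if \<alpha>: "\<alpha> \<ge> pi / 2"
  proof -
    obtain M where M: "M \<in> closed_segment C B" "dist C M = a / 2" "dist M B = a / 2"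
      using point_on_segment_at_distance[of "a / 2" C B] pos by (auto simp: dists)
    have "cos \<alpha> \<le> 0"
      using cos_monotone_0_pi_le[OF _ \<alpha>] range by simp
    then have "b\<^sup>2 + c\<^sup>2 \<le> a\<^sup>2"
      unfolding cos_\<alpha> using pos by (simp add: mult_nonneg_nonpos)
    moreover have "(dist M A)\<^sup>2 = (b\<^sup>2 + c\<^sup>2) / 2 - a\<^sup>2 / 4"
      using on_BC[of M] M cos_\<gamma> by (simp add: closed_segment_commute power2_eq_square)
    ultimately have "(dist M A)\<^sup>2 \<le> (a / 2)\<^sup>2"
      by (simp add: power_divide)
    then have MA: "dist M A \<le> a / 2"
      by (rule power2_le_imp_le) (use pos in simp)
    show ?thesis
      unfolding P
    proof (rule rel_chebyshev_radius_triangle_eqI)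
      show "M \<in> triangle_curve A B C"
        using M by (simp add: triangle_curve_def closed_segment_commute)
      show "a / 2 \<le> dist x A \<or> a / 2 \<le> dist x B \<or> a / 2 \<le> dist x C" for x
        using dist_triangle3[of B C x] sides by linarith
    qed (use M MA in \<open>simp_all add: dist_commute\<close>)
  qed

  have large: "rel_chebyshev_radius P = b * sin \<gamma>" if \<gamma>: "\<gamma> \<ge> pi / 4"
  proof -
    have "cos \<gamma> \<le> sqrt 2 / 2"
      using cos_monotone_0_pi_le[OF _ \<gamma>] range by (simp add: cos_45)
    moreover have \<beta>\<gamma>: "cos \<beta> \<le> cos \<gamma>"
      using cos_monotone_0_pi_le[OF _ angle_order(2)] range by simp
    moreover have cos_\<beta>_nonneg: "0 \<le> cos \<beta>"
    proof -
      have "0 \<le> 2 * c * a * cos \<beta>"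
        using cos_\<beta> power_mono[OF side_order(1), of 2] pos by (smt (verit) zero_le_power2)
      then show ?thesis
        using pos by (auto simp: zero_le_mult_iff mult_le_0_iff)
    qed
    ultimately have "(cos \<beta>)\<^sup>2 \<le> (sqrt 2 / 2)\<^sup>2" "(cos \<gamma>)\<^sup>2 \<le> (sqrt 2 / 2)\<^sup>2"
      by (intro power_mono; linarith)+
    then have half: "(cos \<beta>)\<^sup>2 \<le> 1 / 2" "(cos \<gamma>)\<^sup>2 \<le> 1 / 2"
      by (simp_all add: power_divide)
    have sin_nonneg: "0 \<le> sin \<gamma>" "0 \<le> sin \<beta>"
      using range by (auto intro: sin_ge_zero)

    have projection: "a - b * cos \<gamma> = c * cos \<beta>"
    proof -
      have "a * (a - b * cos \<gamma>) = a * (c * cos \<beta>)"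
        using cos_\<beta> cos_\<gamma> by (simp add: algebra_simps power2_eq_square)
      then show ?thesis
        using pos by simp
    qed
    have "0 \<le> b * cos \<gamma>" "b * cos \<gamma> \<le> a"
      using projection \<beta>\<gamma> cos_\<beta>_nonneg pos by (simp, smt (verit) mult_nonneg_nonneg)
    then obtain H where H: "H \<in> closed_segment C B" "dist C H = b * cos \<gamma>" "dist H B = c * cos \<beta>"
      using point_on_segment_at_distance[of "b * cos \<gamma>" C B] projection by (auto simp: dists)
    have sin2: "(sin \<gamma>)\<^sup>2 = 1 - (cos \<gamma>)\<^sup>2" "(sin \<beta>)\<^sup>2 = 1 - (cos \<beta>)\<^sup>2"
      by (simp_all add: sin_squared_eq)
    have "(dist H A)\<^sup>2 = (b * cos \<gamma>)\<^sup>2 + b\<^sup>2 - 2 * (b * cos \<gamma>) * (b * cos \<gamma>)"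
      using on_BC[of H] H by (simp add: closed_segment_commute)
    also have "\<dots> = (b * sin \<gamma>)\<^sup>2"
      unfolding power_mult_distrib sin2 by algebra
    finally have HA: "dist H A = b * sin \<gamma>"
      by (rule power2_eq_imp_eq) (use pos sin_nonneg in simp_all)
    have "cos \<gamma> \<le> sin \<gamma>"
      by (rule power2_le_imp_le) (use half sin2 sin_nonneg in simp_all)
    then have HC: "dist H C \<le> b * sin \<gamma>"
      using H pos by (simp add: dist_commute)
    have HB: "dist H B \<le> b * sin \<gamma>"
    proof (rule power2_le_imp_le)
      \<comment> \<open>Both legs \<open>HA\<close>, \<open>HB\<close> belong to a right triangle with hypotenuse \<open>c\<close>,
        and \<open>HB\<close> is the shorter one since \<open>\<beta> \<ge> \<pi>/4\<close>.\<close>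
      have "(c * cos \<beta>)\<^sup>2 + (b * sin \<gamma>)\<^sup>2 = c\<^sup>2"
        unfolding projection[symmetric] power_mult_distrib sin2 cos_\<gamma> by algebra
      moreover have "(c * cos \<beta>)\<^sup>2 \<le> c\<^sup>2 * (1 / 2)"
        unfolding power_mult_distrib using half by (intro mult_left_mono) auto
      ultimately show "(dist H B)\<^sup>2 \<le> (b * sin \<gamma>)\<^sup>2"
        using H by simp
    qed (use pos sin_nonneg in simp)

    \<comment> \<open>The other two altitudes are \<open>a * sin \<gamma>\<close> and \<open>a * sin \<beta>\<close>; the sine is compared through
      the cosine, which is nonnegative at \<open>\<beta>\<close> and \<open>\<gamma>\<close>.\<close>
    have ba: "b * sin \<gamma> \<le> a * sin \<gamma>"
      using side_order sin_nonneg by (simp add: mult_right_mono)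
    have "sin \<gamma> \<le> sin \<beta>"
    proof (rule power2_le_imp_le)
      show "(sin \<gamma>)\<^sup>2 \<le> (sin \<beta>)\<^sup>2"
        unfolding sin2 using power_mono[OF \<beta>\<gamma> cos_\<beta>_nonneg, of 2] by simp
    qed (use sin_nonneg in simp)
    then have altitudes: "b * sin \<gamma> \<le> a * sin \<beta>"
      using ba pos by (meson mult_left_mono less_imp_le order_trans)
    show ?thesis
      unfolding P
    proof (rule rel_chebyshev_radius_triangle_eqI)
      show "H \<in> triangle_curve A B C"
        using H by (simp add: triangle_curve_def closed_segment_commute)
      fix x assume "x \<in> triangle_curve A B C"
      then consider "x \<in> closed_segment B A" | "x \<in> closed_segment C B" | "x \<in> closed_segment C A"
        by (auto simp: triangle_curve_def closed_segment_commute)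
      then show "b * sin \<gamma> \<le> dist x A \<or> b * sin \<gamma> \<le> dist x B \<or> b * sin \<gamma> \<le> dist x C"
      proof cases
        case 1
        then show ?thesis
          using altitude_le_dist[of A B C x] neq altitudes by (simp add: dists angles')
      next
        case 2
        then show ?thesis
          using altitude_le_dist[of B C A x] neq by (simp add: dists angles')
      next
        case 3
        then show ?thesis
          using altitude_le_dist[of A C B x] neq ba
          by (simp add: dists angles[symmetric])
      qed
    qed (use HA HB HC in simp_all)
  qed

  have small: "rel_chebyshev_radius P = b / (2 * cos \<gamma>)" if \<gamma>: "\<gamma> \<le> pi / 4" and \<alpha>: "\<alpha> \<le> pi / 2"
  proof -
    define r where "r = b / (2 * cos \<gamma>)"
    have "sqrt 2 / 2 \<le> cos \<gamma>"
      using cos_monotone_0_pi_le[OF _ \<gamma>] range by (simp add: cos_45)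
    then have cos_pos: "0 < cos \<gamma>" and "(sqrt 2 / 2)\<^sup>2 \<le> (cos \<gamma>)\<^sup>2"
      by (rule less_le_trans[rotated], simp) (rule power_mono, fact, simp)
    then have half: "1 / 2 \<le> (cos \<gamma>)\<^sup>2"
      by (simp add: power_divide)
    have r: "0 < r" "2 * r * cos \<gamma> = b"
      using cos_pos pos by (simp_all add: r_def)
    have r_le: "r \<le> b * cos \<gamma>"
    proof -
      have "b * (1 / 2) \<le> b * (cos \<gamma>)\<^sup>2"
        using half pos by (intro mult_left_mono) auto
      then show ?thesis
        using cos_pos unfolding r_def by (simp add: divide_le_eq power2_eq_square mult_ac)
    qed
    have ba: "b * cos \<gamma> \<le> a * cos \<gamma>"
      using side_order cos_pos by simp
    have "a * cos \<gamma> \<le> a"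
      using pos by simp
    then have "r \<le> a"
      using r_le ba by linarith
    then obtain Q where Q: "Q \<in> closed_segment C B" "dist C Q = r" "dist Q B = a - r"
      using point_on_segment_at_distance[of r C B] r by (auto simp: dists)
    have "(dist Q A)\<^sup>2 = r\<^sup>2 + b\<^sup>2 - 2 * r * (b * cos \<gamma>)"
      using on_BC[of Q] Q by (simp add: closed_segment_commute)
    also have "\<dots> = r\<^sup>2"
      unfolding r(2)[symmetric] by algebra
    finally have QA: "dist Q A = r"
      by (rule power2_eq_imp_eq) (use r in simp_all)
    have QB: "a - r \<le> r"
    proof -
      \<comment> \<open>The triangle is not obtuse, so the altitude from \<open>B\<close> meets the side \<open>CA\<close>:
        this is \<open>a * cos \<gamma> \<le> b\<close>.\<close>
      have "0 \<le> cos \<alpha>"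
        using \<alpha> range by (intro cos_ge_zero) auto
      then have "0 \<le> 2 * b * c * cos \<alpha>"
        using pos by simp
      then have "2 * b * (a * cos \<gamma>) \<le> 2 * b * b"
        using cos_\<alpha> cos_\<gamma> by (simp add: algebra_simps power2_eq_square)
      then have "a * cos \<gamma> \<le> b"
        using pos by simp
      then have "a * cos \<gamma> \<le> (2 * r) * cos \<gamma>"
        using r by simp
      then show ?thesis
        using cos_pos by simp
    qed
    \<comment> \<open>Up to the foot of the altitude, a point of a side through \<open>C\<close> comes nearer to the
      vertex opposite to that side as it moves away from \<open>C\<close>.\<close>
    have decreasing: "r\<^sup>2 - 2 * r * h \<le> t\<^sup>2 - 2 * t * h" if "t \<le> r" "r \<le> h" for t h
    proof -
      have "0 \<le> (r - t) * (2 * h - r - t)"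
        using that by (intro mult_nonneg_nonneg) auto
      then show ?thesis
        by (simp add: algebra_simps power2_eq_square)
    qed
    show ?thesis
      unfolding P r_def[symmetric]
    proof (rule rel_chebyshev_radius_triangle_eqI)
      show "Q \<in> triangle_curve A B C"
        using Q by (simp add: triangle_curve_def closed_segment_commute)
      fix x assume "x \<in> triangle_curve A B C"
      then consider "x \<in> closed_segment A B" | "x \<in> closed_segment B C" | "x \<in> closed_segment C A"
        by (auto simp: triangle_curve_def)
      then show "r \<le> dist x A \<or> r \<le> dist x B \<or> r \<le> dist x C"
      proof cases
        case 1
        \<comment> \<open>As \<open>b \<le> a\<close>, the altitude from \<open>C\<close> has its foot at most \<open>c / 2\<close> away from \<open>A\<close>, so
          its length is at least \<open>sqrt (b\<^sup>2 - c\<^sup>2 / 4) \<ge> b * sqrt (3 / 4)\<close>.\<close>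
        let ?t = "dist A x"
        have "(dist x C)\<^sup>2 = ?t\<^sup>2 + b\<^sup>2 - 2 * ?t * b * cos \<alpha>"
          using law_of_cosines_on_side[of B A C x] neq 1 by (simp add: dists angles)
        moreover have "b * cos \<alpha> \<le> c / 2"
        proof -
          have "2 * b * c * cos \<alpha> \<le> c\<^sup>2"
            using cos_\<alpha> power_mono[OF side_order(1), of 2] pos by simp
          then have "c * (2 * (b * cos \<alpha>)) \<le> c * c"
            by (simp only: power2_eq_square mult_ac)
          then show ?thesis
            using pos by simp
        qed
        then have "2 * ?t * (b * cos \<alpha>) \<le> 2 * ?t * (c / 2)"
          by (intro mult_left_mono) auto
        moreover have "0 \<le> (?t - c / 2)\<^sup>2"
          by simp
        ultimately have "b\<^sup>2 - c\<^sup>2 / 4 \<le> (dist x C)\<^sup>2"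
          by (simp add: power2_eq_square algebra_simps)
        moreover have "c\<^sup>2 \<le> b\<^sup>2"
          using side_order pos by (intro power_mono) auto
        moreover have "r\<^sup>2 \<le> b\<^sup>2 / 2"
        proof -
          have "r\<^sup>2 * (1 / 2) \<le> r\<^sup>2 * (cos \<gamma>)\<^sup>2"
            using half by (intro mult_left_mono) auto
          also have "\<dots> = b\<^sup>2 / 4"
            unfolding r(2)[symmetric] by (simp add: power_mult_distrib)
          finally show ?thesis
            by simp
        qed
        ultimately have "r\<^sup>2 \<le> (dist x C)\<^sup>2"
          using zero_le_power2[of b] by linarith
        then have "r \<le> dist x C"
          by (rule power2_le_imp_le) simp
        then show ?thesis
          by simp
      next
        case 2
        show ?thesis
        proof (cases "r \<le> dist x C")
          case False
          then have "r\<^sup>2 - 2 * r * (b * cos \<gamma>) \<le> (dist C x)\<^sup>2 - 2 * dist C x * (b * cos \<gamma>)"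
            using r_le by (intro decreasing) (auto simp: dist_commute)
          moreover have "2 * r * (b * cos \<gamma>) = b\<^sup>2"
            unfolding r(2)[symmetric] by algebra
          ultimately have "r\<^sup>2 \<le> (dist x A)\<^sup>2"
            using on_BC[OF 2] by linarith
          then have "r \<le> dist x A"
            by (rule power2_le_imp_le) simp
          then show ?thesis
            by simp
        qed simp
      next
        case 3
        show ?thesis
        proof (cases "r \<le> dist x C")
          case False
          then have "r\<^sup>2 - 2 * r * (a * cos \<gamma>) \<le> (dist C x)\<^sup>2 - 2 * dist C x * (a * cos \<gamma>)"
            using r_le ba by (intro decreasing) (auto simp: dist_commute)
          moreover have "2 * r * (a * cos \<gamma>) = a * b"
            unfolding r(2)[symmetric] by algebra
          moreover have "a * b \<le> a\<^sup>2"
            using side_order pos by (simp add: power2_eq_square)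
          ultimately have "r\<^sup>2 \<le> (dist x B)\<^sup>2"
            using on_CA[OF 3] by linarith
          then have "r \<le> dist x B"
            by (rule power2_le_imp_le) simp
          then show ?thesis
            by simp
        qed simp
      qed
    qed (use Q QA QB in \<open>simp_all add: dist_commute\<close>)
  qed

  show ?thesis
    using obtuse large small by blast
qed

end
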